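(* Let $f:\mathbb{R}^n\to\mathbb{R}$ be locally Lipschitz continuous, let $\tilde f$ be a smoothing function of $f$, and let $\nabla_x\tilde f(x,\xi,\mu)$ denote stochastic gradient estimates of $\nabla_x \tilde f(x,\mu)$. Suppose that: (1) $\mathbb{E}_\xi[\nabla_x\tilde f(x,\xi,\mu)]=\nabla_x\tilde f(x,\mu)$ for all $x\in\mathbb{R}^n$, $\mu>0$; (2) there is $G>0$ with $\mathbb{E}_\xi[\|\nabla_x\tilde f(x,\xi,\mu)\|^2]\le G^2/\mu^2$ for all $x\in\mathbb{R}^n$, $\mu>0$; (3) there is $C>0$ with $|f(x)-\tilde f(x,\mu)|\le C\mu$ for all $x\in\mathbb{R}^n$, $\mu>0$; (4) there is $C_0>0$ such that for all $\mu>0$ the gradient $\nabla_x\tilde f(\cdot,\mu)$ is Lipschitz continuous on $\mathbb{R}^n$ with constant $C_0/\mu$; (5) there is $C_1>0$ such that $|\tilde f(x,\mu')-\tilde f(x,\mu)|\le C_1|\mu'-\mu|$ for all $x\in\mathbb{R}^n$ and all $\mu,\mu'>0$. Let $d\in(1,2)$ and let the smoothing stochastic gradient (SSG) method run with diminishing stepsizes $\{\alpha_k\}$ satisfying $\sum_{k=1}^\infty\alpha_k=\infty$ and $\sum_{k=1}^\infty\alpha_k^d<\infty$, and smoothing parameters $\mu_k=\alpha_k^{-\frac d3+\frac23}$. Then $$\lim_{T\to\infty}\mathbb{E}\left[\sum_{k=1}^T\alpha_k\|\nabla_x\tilde f(x_k,\mu_k)\|^2\right]<\infty.$$ Moreover,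 with $A_T=\sum_{k=1}^T\alpha_k$, $$\lim_{T\to\infty}\mathbb{E}\left[\frac1{A_T}\sum_{k=1}^T\alpha_k\|\nabla_x\tilde f(x_k,\mu_k)\|^2\right]=0.$$
   Context: The problem considered is $\min_{x\in\mathbb{R}^n} f(x)$, with $f$ possibly non-smooth and non-convex. Smoothing function: for a locally Lipschitz continuous $f:\mathbb{R}^n\to\mathbb{R}$, a function $\tilde f:\mathbb{R}^n\times[0,+\infty)\to\mathbb{R}$ is a smoothing function of $f$ if for every $\mu>0$, $\tilde f(\cdot,\mu)$ is continuously differentiable on $\mathbb{R}^n$, and for every $x\in\mathbb{R}^n$, $\lim_{z\to x,\,\mu\downarrow 0}\tilde f(z,\mu)=f(x)$. Here $\nabla_x\tilde f(x,\mu)$ is the gradient of $\tilde f(\cdot,\mu)$ at $x$. $\xi$ is a random vector. For each $x$, each $\mu>0$ and each realization of $\xi$, $\nabla_x\tilde f(x,\xi,\mu)\in\mathbb{R}^n$ is a stochastic gradient estimate; $\mathbb{E}_\xi$ is the expectation with respect to the distribution of $\xi$. SSG method: given an initial point $x_1$, positive stepsizes $\{\alpha_k\}$ and positive smoothing parameters $\{\mu_k\}$ with $\mu_{k+1}\le\mu_k$, for $k=1,2,\dots$ generate a realization $\xi_k$ of $\xi$ and set $x_{k+1}=x_k-\alpha_k\nabla_x\tilde f(x_k,\xi_k,\mu_k)$. $\mathbb{E}$ denotes the total expectation over the randomness of the method.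
   Formalization: The first limit (finiteness) is proved only for f bounded below; without this it is false, e.g. f(x) = -(1+x^2)^(1/4) with smoothing -(1+x^2+mu^4)^(1/4), exact gradients and alpha_k = 1/k. The second limit is proved without this assumption. *)

theory Defs
  imports "HOL-Analysis.Analysis" "HOL-Probability.Probability"
begin

(* Only meaningful where h is differentiable; GDERIV is the library's relation
   between a function, a point and its gradient there. *)
definition grad :: "('a::real_inner \<Rightarrow> real) \<Rightarrow> 'a \<Rightarrow> 'a" where
  "grad h x = (THE D. GDERIV h x :> D)"

definition continuously_differentiable :: "('a::real_inner \<Rightarrow> real) \<Rightarrow> bool" where
  "continuously_differentiable h \<longleftrightarrow>
     (\<forall>x. h differentiable (at x)) \<and> continuous_on UNIV (grad h)"

definition locally_lipschitz :: "('a::metric_space \<Rightarrow> 'b::metric_space) \<Rightarrow> bool" where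
  "locally_lipschitz f \<longleftrightarrow> (\<forall>x. \<exists>e>0. \<exists>L. L-lipschitz_on (ball x e) f)"

(* The smoothing parameter ranges over [0, \<infinity>) in the literature; here it is a
   real, and values at negative parameters are unconstrained junk.  In the limit z may
   equal x (nhds x, not at x), whereas the smoothing parameter stays positive. *)
definition smoothing_function ::
    "(real^'n \<Rightarrow> real) \<Rightarrow> (real^'n \<Rightarrow> real \<Rightarrow> real) \<Rightarrow> bool" where
  "smoothing_function f F \<longleftrightarrow>
     (\<forall>\<mu>>0. continuously_differentiable (\<lambda>x. F x \<mu>)) \<and>
     (\<forall>x. ((\<lambda>(z, \<mu>). F z \<mu>) \<longlongrightarrow> f x) (nhds x \<times>\<^sub>F at_right 0))"

(* M is the probability space on which the method runs and P the distribution of the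
   random vector; the draws at iterations 1, 2, ... are independent with law P.
   The iterates, stepsizes and smoothing parameters are indexed from 1; index 0 is unused.
   The initial point is deterministic. *)
definition ssg_method ::
    "'s measure \<Rightarrow> (real^'m) measure \<Rightarrow> (real^'n \<Rightarrow> real^'m \<Rightarrow> real \<Rightarrow> real^'n) \<Rightarrow>
     real^'n \<Rightarrow> (nat \<Rightarrow> real) \<Rightarrow> (nat \<Rightarrow> real) \<Rightarrow>
     (nat \<Rightarrow> 's \<Rightarrow> real^'m) \<Rightarrow> (nat \<Rightarrow> 's \<Rightarrow> real^'n) \<Rightarrow> bool" where
  "ssg_method M P g x\<^sub>1 \<alpha> \<mu> \<xi> x \<longleftrightarrow>
     prob_space M \<and>
     prob_space.indep_vars M (\<lambda>_. borel) \<xi> {1..} \<and>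
     (\<forall>k\<ge>1. distr M borel (\<xi> k) = P) \<and>
     (\<forall>k\<ge>1. \<alpha> k > 0 \<and> \<mu> k > 0 \<and> \<mu> (Suc k) \<le> \<mu> k) \<and>
     (\<forall>\<omega>\<in>space M. x 1 \<omega> = x\<^sub>1) \<and>
     (\<forall>k\<ge>1. \<forall>\<omega>\<in>space M. x (Suc k) \<omega> = x k \<omega> - \<alpha> k *\<^sub>R g (x k \<omega>) (\<xi> k \<omega>) (\<mu> k))"

end

theory Submission
  imports Defs
begin

text \<open>
  The next draw is independent of the current iterate, so the Lipschitz gradient of the smoothing
  function gives the expected descent estimate
  \<open>\<alpha>\<^sub>k E\<parallel>\<nabla>F(x\<^sub>k, \<mu>\<^sub>k)\<parallel>\<^sup>2 \<le> E F(x\<^sub>k, \<mu>\<^sub>k) - E F(x\<^bsub>k+1\<^esub>, \<mu>\<^sub>k) + C\<^sub>0 G\<^sup>2 \<alpha>\<^sub>k\<^sup>2 / \<mu>\<^sub>k\<^sup>3\<close>,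
  whose last term is \<open>C\<^sub>0 G\<^sup>2 \<alpha>\<^sub>k\<^sup>d\<close> and hence summable; the change of smoothing parameter
  telescopes. If \<open>f\<close> is bounded below, this bounds \<open>S\<^sub>T = \<Sum>\<^bsub>k\<le>T\<^esub> \<alpha>\<^sub>k E\<parallel>\<nabla>F(x\<^sub>k, \<mu>\<^sub>k)\<parallel>\<^sup>2\<close>.

  For the weighted average no lower bound on \<open>f\<close> is needed. By Jensen's inequality the second moment
  bound yields \<open>\<parallel>\<nabla>F(\<cdot>, s)\<parallel> \<le> G / s\<close> for every \<open>s > 0\<close>. Following \<open>F(\<cdot>, s)\<close> along the iterates for a
  fixed large \<open>s\<close> shows that \<open>E F(x\<^bsub>T+1\<^esub>, s)\<close> decreases by at most \<open>K\<^sub>s + G / (2 s) (A\<^sub>T + S\<^sub>T)\<close>, and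
  \<open>F(\<cdot>, s)\<close> and \<open>F(\<cdot>, \<mu>)\<close> differ by a constant. Hence \<open>S\<^sub>T \<le> K\<^sub>s + \<delta> (A\<^sub>T + S\<^sub>T)\<close> with \<open>\<delta> = G / (2 s)\<close>
  arbitrarily small.
\<close>

section \<open>Gradients and mean value estimates\<close>

text \<open>A linear functional on a Euclidean space is the inner product with the vector of its
  values on \<open>Basis\<close>. With uniqueness of the derivative, this makes the
  \<open>THE\<close> in \<open>grad\<close> well defined.\<close>

lemma GDERIV_grad:
  fixes h :: "'a::euclidean_space \<Rightarrow> real"
  assumes "h differentiable (at x)"
  shows "GDERIV h x :> grad h x"
proof -
  obtain h' where h': "(h has_derivative h') (at x)"
    using assms by (auto simp: differentiable_def)
  define D where "D = (\<Sum>b\<in>Basis. h' b *\<^sub>R b)"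
  have lin: "linear h'"
    using h' by (rule has_derivative_linear)
  have "h' v = inner v D" for v
  proof -
    have "h' v = h' (\<Sum>b\<in>Basis. inner v b *\<^sub>R b)"
      by (simp add: euclidean_representation)
    also have "\<dots> = (\<Sum>b\<in>Basis. inner v b *\<^sub>R h' b)"
      using lin by (simp add: linear_sum linear_scale)
    also have "\<dots> = inner v D"
      by (simp add: D_def inner_sum_right mult.commute)
    finally show ?thesis .
  qed
  then have "h' = (\<lambda>v. inner v D)"
    by blast
  with h' have D: "GDERIV h x :> D"
    by (simp add: gderiv_def)
  moreover have "E = D" if "GDERIV h x :> E" for E
  proof -
    have "(\<lambda>v. inner v E) = (\<lambda>v. inner v D)"
      using that D unfolding gderiv_def by (rule has_derivative_unique)
    then have "inner (E - D) E = inner (E - D) D"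
      by (rule fun_cong)
    then show ?thesis
      by (metis eq_iff_diff_eq_0 inner_diff_right inner_eq_zero_iff)
  qed
  ultimately show ?thesis
    unfolding grad_def by (rule theI)
qed

text \<open>The one-dimensional mean value theorem is applied to \<open>H\<close> along the segment
  from \<open>y\<close> to \<open>y + v\<close>.\<close>

lemma GDERIV_mvt:
  fixes H :: "'a::real_inner \<Rightarrow> real"
  assumes "\<And>y. GDERIV H y :> h y"
  obtains t where "t \<in> {0..1}" "H (y + v) - H y = inner v (h (y + t *\<^sub>R v))"
proof -
  have "((\<lambda>t. H (y + t *\<^sub>R v)) has_derivative (\<lambda>r. inner (r *\<^sub>R v) (h (y + t *\<^sub>R v))))
      (at t within {0..1})" for t
  proof (rule has_derivative_compose[where g = H])
    show "((\<lambda>t. y + t *\<^sub>R v) has_derivative (\<lambda>r. r *\<^sub>R v)) (at t within {0..1})"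
      by (auto intro!: derivative_eq_intros)
    show "(H has_derivative (\<lambda>w. inner w (h (y + t *\<^sub>R v)))) (at (y + t *\<^sub>R v))"
      using assms by (simp add: gderiv_def)
  qed
  then obtain t where "t \<in> {0..1}"
    "H (y + 1 *\<^sub>R v) - H (y + 0 *\<^sub>R v) = inner ((1 - 0) *\<^sub>R v) (h (y + t *\<^sub>R v))"
    using mvt_very_simple[of 0 1 "\<lambda>t. H (y + t *\<^sub>R v)"
        "\<lambda>t r. inner (r *\<^sub>R v) (h (y + t *\<^sub>R v))"] by auto
  then show ?thesis
    by (intro that[of t]) auto
qed

lemma GDERIV_bound:
  fixes H :: "'a::real_inner \<Rightarrow> real"
  assumes "\<And>y. GDERIV H y :> h y" and "\<And>y. norm (h y) \<le> B"
  shows "\<bar>H (y + v) - H y\<bar> \<le> B * norm v"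
proof -
  obtain t where "H (y + v) - H y = inner v (h (y + t *\<^sub>R v))"
    using GDERIV_mvt[OF assms(1)] by blast
  then have "\<bar>H (y + v) - H y\<bar> \<le> norm v * norm (h (y + t *\<^sub>R v))"
    by (simp add: Cauchy_Schwarz_ineq2)
  also have "\<dots> \<le> norm v * B"
    by (intro mult_left_mono assms) auto
  finally show ?thesis
    by (simp add: mult.commute)
qed

text \<open>By the mean value theorem the remainder is \<open>v\<close> paired with a difference of
  gradients at points at most \<open>norm v\<close> apart. This gives \<open>L\<close> where
  integration along the segment would give \<open>L / 2\<close>; only summability of the errors
  matters later.\<close>

lemma GDERIV_lipschitz_remainder:
  fixes H :: "'a::real_inner \<Rightarrow> real"
  assumes "\<And>y. GDERIV H y :> h y" and lip: "L-lipschitz_on UNIV h"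
  shows "\<bar>H (y + v) - H y - inner v (h y)\<bar> \<le> L * (norm v)\<^sup>2"
proof -
  obtain t where t: "t \<in> {0..1}" "H (y + v) - H y = inner v (h (y + t *\<^sub>R v))"
    using GDERIV_mvt[OF assms(1)] by blast
  have L: "L \<ge> 0"
    using lip by (rule lipschitz_on_nonneg)
  have "\<bar>H (y + v) - H y - inner v (h y)\<bar> = \<bar>inner v (h (y + t *\<^sub>R v) - h y)\<bar>"
    using t by (simp add: inner_diff_right)
  also have "\<dots> \<le> norm v * norm (h (y + t *\<^sub>R v) - h y)"
    by (rule Cauchy_Schwarz_ineq2)
  also have "norm (h (y + t *\<^sub>R v) - h y) \<le> L * norm (t *\<^sub>R v)"
    using lipschitz_onD[OF lip, of "y + t *\<^sub>R v" y] by (simp add: dist_norm)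
  also have "L * norm (t *\<^sub>R v) \<le> L * norm v"
    using t L by (intro mult_left_mono) (auto intro: mult_left_le_one_le)
  finally show ?thesis
    by (simp add: power2_eq_square mult.left_commute mult_left_mono)
qed

section \<open>Expectations over an independent draw\<close>

text \<open>Jensen's inequality in two steps: the norm of an integral is at most the integral of the
  norm, and the variance of the norm is nonnegative.\<close>

lemma (in prob_space) norm_expectation_sq_le:
  fixes X :: "'a \<Rightarrow> 'b::{banach, second_countable_topology}"
  assumes "integrable M X" and "integrable M (\<lambda>\<omega>. (norm (X \<omega>))\<^sup>2)"
  shows "(norm (expectation X))\<^sup>2 \<le> expectation (\<lambda>\<omega>. (norm (X \<omega>))\<^sup>2)"
proof -
  have "norm (expectation X) \<le> expectation (\<lambda>\<omega>. norm (X \<omega>))"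
    by (rule integral_norm_bound)
  then have "(norm (expectation X))\<^sup>2 \<le> (expectation (\<lambda>\<omega>. norm (X \<omega>)))\<^sup>2"
    by (intro power_mono) auto
  also have "\<dots> \<le> expectation (\<lambda>\<omega>. (norm (X \<omega>))\<^sup>2)"
    using variance_positive[of "\<lambda>\<omega>. norm (X \<omega>)"] variance_eq[of "\<lambda>\<omega>. norm (X \<omega>)"] assms by simp
  finally show ?thesis .
qed

text \<open>Independence is expressed through the product of laws, since the library's binary
  independence predicate forces both variables to have the same type.\<close>

lemma (in prob_space) product_law_freeze:
  fixes \<phi> :: "'b \<times> 'c \<Rightarrow> 'd::{banach, second_countable_topology}"
  assumes rv [measurable]: "random_variable S X" "random_variable T Z"
    and P: "distr M T Z = P"
    and joint: "distr M (S \<Otimes>\<^sub>M T) (\<lambda>\<omega>. (X \<omega>, Z \<omega>)) = distr M S X \<Otimes>\<^sub>M P"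
    and meas: "\<phi> \<in> borel_measurable (S \<Otimes>\<^sub>M T)"
    and int: "\<And>y. integrable P (\<lambda>z. \<phi> (y, z))"
    and bound: "\<And>y. (LINT z|P. norm (\<phi> (y, z))) \<le> B"
  shows "integrable M (\<lambda>\<omega>. \<phi> (X \<omega>, Z \<omega>))"
    and "expectation (\<lambda>\<omega>. \<phi> (X \<omega>, Z \<omega>)) = expectation (\<lambda>\<omega>. LINT z|P. \<phi> (X \<omega>, z))"
proof -
  interpret X: prob_space "distr M S X"
    by (rule prob_space_distr) measurable
  interpret Q: prob_space P
    unfolding P[symmetric] by (rule prob_space_distr) measurable
  interpret pair: pair_prob_space "distr M S X" P ..
  have sets_P [measurable_cong]: "sets P = sets T"
    unfolding P[symmetric] by simp
  note meas [measurable]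
  have m2: "(\<lambda>y. LINT z|P. \<phi> (y, z)) \<in> borel_measurable S"
    by measurable
  \<comment> \<open>\<open>B\<close> is uniform in \<open>y\<close>, so the inner integral of the
    norm is a bounded function on a probability space and Fubini's criterion applies.\<close>
  have prod: "integrable (distr M S X \<Otimes>\<^sub>M P) \<phi>"
  proof (rule pair.Fubini_integrable)
    show "integrable (distr M S X) (\<lambda>y. LINT z|P. norm (\<phi> (y, z)))"
      by (rule X.integrable_const_bound[where B = B]) (auto intro!: AE_I2 bound)
  qed (use int in auto)
  then show "integrable M (\<lambda>\<omega>. \<phi> (X \<omega>, Z \<omega>))"
    unfolding joint[symmetric] by (subst (asm) integrable_distr_eq) auto
  have "expectation (\<lambda>\<omega>. \<phi> (X \<omega>, Z \<omega>)) = integral\<^sup>L (distr M S X \<Otimes>\<^sub>M P) \<phi>"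
    unfolding joint[symmetric] by (subst integral_distr) auto
  also have "\<dots> = (LINT y|distr M S X. LINT z|P. \<phi> (y, z))"
    by (rule pair.integral_fst'[OF prod, symmetric])
  also have "\<dots> = expectation (\<lambda>\<omega>. LINT z|P. \<phi> (X \<omega>, z))"
    by (rule integral_distr) (use m2 in auto)
  finally show "expectation (\<lambda>\<omega>. \<phi> (X \<omega>, Z \<omega>)) = expectation (\<lambda>\<omega>. LINT z|P. \<phi> (X \<omega>, z))" .
qed

text \<open>The mean \<open>m\<close> of the estimate and the gradient \<open>h\<close> of the
  tracked function \<open>H\<close> are kept apart: \<open>m = h\<close> gives the descent estimate,
  a flatter \<open>H\<close> gives the drift estimate. The former uses the upper half of the
  two-sided bound, the latter the lower half.\<close>

lemma (in prob_space) stochastic_step: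
  fixes H :: "'b::euclidean_space \<Rightarrow> real" and Z :: "'a \<Rightarrow> 'c::euclidean_space"
  assumes rv [measurable]: "random_variable borel X" "random_variable borel Z"
    and P: "distr M borel Z = P"
    and joint: "distr M (borel \<Otimes>\<^sub>M borel) (\<lambda>\<omega>. (X \<omega>, Z \<omega>)) = distr M borel X \<Otimes>\<^sub>M P"
    and meas: "(\<lambda>(y, z). \<gamma> y z) \<in> borel_measurable (borel \<Otimes>\<^sub>M borel)"
    and mean: "\<And>y. has_bochner_integral P (\<lambda>z. \<gamma> y z) (m y)"
    and sq: "\<And>y. integrable P (\<lambda>z. (norm (\<gamma> y z))\<^sup>2)"
      "\<And>y. (LINT z|P. (norm (\<gamma> y z))\<^sup>2) \<le> V"
    and H: "\<And>y. GDERIV H y :> h y" and lip: "L-lipschitz_on UNIV h"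
    and bound: "\<And>y. norm (h y) \<le> B"
    and HX: "integrable M (\<lambda>\<omega>. H (X \<omega>))"
  shows "integrable M (\<lambda>\<omega>. H (X \<omega> - a *\<^sub>R \<gamma> (X \<omega>) (Z \<omega>)))"
    and "\<bar>expectation (\<lambda>\<omega>. H (X \<omega> - a *\<^sub>R \<gamma> (X \<omega>) (Z \<omega>))) - expectation (\<lambda>\<omega>. H (X \<omega>))
          + a * expectation (\<lambda>\<omega>. inner (m (X \<omega>)) (h (X \<omega>)))\<bar> \<le> L * (a\<^sup>2 * V)"
proof -
  let ?Y = "\<lambda>\<omega>. X \<omega> - a *\<^sub>R \<gamma> (X \<omega>) (Z \<omega>)"
  interpret P: prob_space P
    unfolding P[symmetric] by (rule prob_space_distr) measurable
  note meas [measurable]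
  have [measurable]: "h \<in> borel_measurable borel"
    by (intro borel_measurable_continuous_onI lipschitz_on_continuous_on[OF lip])
  have "isCont H y" for y
    using H has_derivative_continuous unfolding gderiv_def by blast
  then have [measurable]: "H \<in> borel_measurable borel"
    by (intro borel_measurable_continuous_onI continuous_at_imp_continuous_on) auto
  have \<gamma>: "integrable P (\<lambda>z. \<gamma> y z)" "(LINT z|P. \<gamma> y z) = m y" for y
    using mean[of y] by (auto simp: has_bochner_integral_iff)
  \<comment> \<open>A crude first moment bound from \<open>t \<le> 1 + t\<^sup>2\<close>; it serves
    only to secure integrability of the cross term.\<close>
  have abs_le: "(LINT z|P. norm (\<gamma> y z)) \<le> 1 + V" for y
  proof -
    have "(LINT z|P. norm (\<gamma> y z)) \<le> (LINT z|P. 1 + (norm (\<gamma> y z))\<^sup>2)"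
    proof (rule integral_mono)
      show "norm (\<gamma> y z) \<le> 1 + (norm (\<gamma> y z))\<^sup>2" for z
        using sum_squares_bound[of 1 "norm (\<gamma> y z)"] norm_ge_zero[of "\<gamma> y z"]
        unfolding power_one by linarith
    qed (use \<gamma> sq in auto)
    also have "\<dots> \<le> 1 + V"
      using sq by (simp add: P.prob_space)
    finally show ?thesis .
  qed
  have sq_int: "integrable M (\<lambda>\<omega>. (norm (\<gamma> (X \<omega>) (Z \<omega>)))\<^sup>2)"
    and sq_eq: "expectation (\<lambda>\<omega>. (norm (\<gamma> (X \<omega>) (Z \<omega>)))\<^sup>2)
        = expectation (\<lambda>\<omega>. LINT z|P. (norm (\<gamma> (X \<omega>) z))\<^sup>2)"
    using product_law_freeze[OF rv P joint, of "\<lambda>(y, z). (norm (\<gamma> y z))\<^sup>2" V] sq by auto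
  have sq_le: "expectation (\<lambda>\<omega>. (norm (\<gamma> (X \<omega>) (Z \<omega>)))\<^sup>2) \<le> V"
    unfolding sq_eq
  proof (rule integral_le_const)
    have [measurable_cong]: "sets P = sets borel"
      unfolding P[symmetric] by simp
    have "(\<lambda>\<omega>. LINT z|P. (norm (\<gamma> (X \<omega>) z))\<^sup>2) \<in> borel_measurable M"
      by measurable
    then show "integrable M (\<lambda>\<omega>. LINT z|P. (norm (\<gamma> (X \<omega>) z))\<^sup>2)"
      by (rule integrable_const_bound[where B = V, rotated]) (simp add: sq(2))
    show "AE \<omega> in M. (LINT z|P. (norm (\<gamma> (X \<omega>) z))\<^sup>2) \<le> V"
      by (simp add: sq(2))
  qed
  have \<gamma>_int: "integrable M (\<lambda>\<omega>. norm (\<gamma> (X \<omega>) (Z \<omega>)))"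
    by (rule square_integrable_imp_integrable[OF _ sq_int]) measurable
  have inner_P: "integrable P (\<lambda>z. inner (\<gamma> y z) (h y))" for y
    using \<gamma>(1) by (rule integrable_inner_left)
  have inner_bound: "(LINT z|P. norm (inner (\<gamma> y z) (h y))) \<le> (1 + V) * B" for y
  proof -
    have B: "B \<ge> 0"
      using norm_ge_zero[of "h y"] bound[of y] by linarith
    have "(LINT z|P. norm (inner (\<gamma> y z) (h y))) \<le> (LINT z|P. norm (\<gamma> y z) * B)"
    proof (rule integral_mono)
      show "norm (inner (\<gamma> y z) (h y)) \<le> norm (\<gamma> y z) * B" for z
        using Cauchy_Schwarz_ineq2[of "\<gamma> y z" "h y"]
          mult_left_mono[OF bound[of y], of "norm (\<gamma> y z)"] by simp
    qed (use inner_P \<gamma> in auto)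
    also have "\<dots> \<le> (1 + V) * B"
      using abs_le B by (simp add: mult_right_mono)
    finally show ?thesis .
  qed
  \<comment> \<open>With the iterate frozen, averaging over the draw replaces the estimate by its
    mean \<open>m\<close>.\<close>
  have inner_int: "integrable M (\<lambda>\<omega>. inner (\<gamma> (X \<omega>) (Z \<omega>)) (h (X \<omega>)))"
    and "expectation (\<lambda>\<omega>. inner (\<gamma> (X \<omega>) (Z \<omega>)) (h (X \<omega>)))
        = expectation (\<lambda>\<omega>. LINT z|P. inner (\<gamma> (X \<omega>) z) (h (X \<omega>)))"
    using product_law_freeze[OF rv P joint, of "\<lambda>(y, z). inner (\<gamma> y z) (h y)" "(1 + V) * B"]
      inner_P inner_bound by auto
  then have inner_eq: "expectation (\<lambda>\<omega>. inner (\<gamma> (X \<omega>) (Z \<omega>)) (h (X \<omega>)))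
        = expectation (\<lambda>\<omega>. inner (m (X \<omega>)) (h (X \<omega>)))"
    using \<gamma> by (simp add: integral_inner_left)
  \<comment> \<open>\<open>H\<close> may be unbounded, but its increment is dominated by a multiple
    of the step length; integrability thus passes from \<open>H (X \<omega>)\<close> to the next
    value.\<close>
  have diff_int: "integrable M (\<lambda>\<omega>. H (?Y \<omega>) - H (X \<omega>))"
  proof (rule Bochner_Integration.integrable_bound)
    show "integrable M (\<lambda>\<omega>. B * (\<bar>a\<bar> * norm (\<gamma> (X \<omega>) (Z \<omega>))))"
      using \<gamma>_int by auto
    show "AE \<omega> in M. norm (H (?Y \<omega>) - H (X \<omega>)) \<le> norm (B * (\<bar>a\<bar> * norm (\<gamma> (X \<omega>) (Z \<omega>))))"
    proof (rule AE_I2)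
      fix \<omega>
      show "norm (H (?Y \<omega>) - H (X \<omega>)) \<le> norm (B * (\<bar>a\<bar> * norm (\<gamma> (X \<omega>) (Z \<omega>))))"
        using GDERIV_bound[OF H bound, of "X \<omega>" "- (a *\<^sub>R \<gamma> (X \<omega>) (Z \<omega>))"] by simp
    qed
  qed measurable
  from Bochner_Integration.integrable_add[OF this HX]
  show Y_int: "integrable M (\<lambda>\<omega>. H (?Y \<omega>))"
    by simp
  \<comment> \<open>The first-order Taylor remainder of \<open>H\<close> at
    \<open>X \<omega>\<close> for the random step.\<close>
  let ?R = "\<lambda>\<omega>. H (?Y \<omega>) - H (X \<omega>) + a * inner (\<gamma> (X \<omega>) (Z \<omega>)) (h (X \<omega>))"
  have R_int: "integrable M ?R"
    using diff_int inner_int by auto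
  have "expectation (\<lambda>\<omega>. H (?Y \<omega>)) - expectation (\<lambda>\<omega>. H (X \<omega>))
      + a * expectation (\<lambda>\<omega>. inner (m (X \<omega>)) (h (X \<omega>))) = expectation ?R"
    using Y_int HX inner_int by (simp add: inner_eq)
  also have "\<bar>\<dots>\<bar> \<le> expectation (\<lambda>\<omega>. \<bar>?R \<omega>\<bar>)"
    by (rule integral_abs_bound)
  also have "\<dots> \<le> expectation (\<lambda>\<omega>. L * (a\<^sup>2 * (norm (\<gamma> (X \<omega>) (Z \<omega>)))\<^sup>2))"
  proof (rule integral_mono)
    show "\<bar>?R \<omega>\<bar> \<le> L * (a\<^sup>2 * (norm (\<gamma> (X \<omega>) (Z \<omega>)))\<^sup>2)" for \<omega>
      using GDERIV_lipschitz_remainder[OF H lip, of "X \<omega>" "- (a *\<^sub>R \<gamma> (X \<omega>) (Z \<omega>))"]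
      by (simp add: power_mult_distrib)
  qed (use R_int sq_int in auto)
  also have "\<dots> \<le> L * (a\<^sup>2 * V)"
    using sq_le lipschitz_on_nonneg[OF lip] by (simp add: mult_left_mono)
  finally show "\<bar>expectation (\<lambda>\<omega>. H (?Y \<omega>)) - expectation (\<lambda>\<omega>. H (X \<omega>))
      + a * expectation (\<lambda>\<omega>. inner (m (X \<omega>)) (h (X \<omega>)))\<bar> \<le> L * (a\<^sup>2 * V)" .
qed

section \<open>Independence of the current iterate and the next draw\<close>

text \<open>The iterate with index \<open>k\<close> is a measurable function of the draws with
  indices in \<open>{1..<k}\<close>, a block disjoint from \<open>{k}\<close>.\<close>

lemma (in prob_space) product_law_recursion:
  fixes X :: "nat \<Rightarrow> 'a \<Rightarrow> 'b" and \<xi> :: "nat \<Rightarrow> 'a \<Rightarrow> 'c"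
  assumes ind: "indep_vars (\<lambda>_. T) \<xi> {1..}"
    and init: "\<And>\<omega>. \<omega> \<in> space M \<Longrightarrow> X 1 \<omega> = x\<^sub>1" "x\<^sub>1 \<in> space S"
    and step: "\<And>k \<omega>. k \<ge> 1 \<Longrightarrow> \<omega> \<in> space M \<Longrightarrow> X (Suc k) \<omega> = \<Psi> k (X k \<omega>, \<xi> k \<omega>)"
    and meas: "\<And>k. k \<ge> 1 \<Longrightarrow> \<Psi> k \<in> measurable (S \<Otimes>\<^sub>M T) S"
    and k: "k \<ge> 1"
  shows "random_variable S (X k)"
    and "distr M (S \<Otimes>\<^sub>M T) (\<lambda>\<omega>. (X k \<omega>, \<xi> k \<omega>)) = distr M S (X k) \<Otimes>\<^sub>M distr M T (\<xi> k)"
proof -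
  have "\<exists>\<phi> \<in> measurable (PiM {1..<k} (\<lambda>_. T)) S.
      \<forall>\<omega>\<in>space M. X k \<omega> = \<phi> (restrict (\<lambda>i. \<xi> i \<omega>) {1..<k})"
    using k
  proof (induction k rule: nat_induct_at_least)
    case base
    then show ?case
      using init by (intro bexI[of _ "\<lambda>_. x\<^sub>1"]) auto
  next
    case (Suc n)
    then obtain \<phi> where \<phi> [measurable]: "\<phi> \<in> measurable (PiM {1..<n} (\<lambda>_. T)) S"
      and eq: "\<And>\<omega>. \<omega> \<in> space M \<Longrightarrow> X n \<omega> = \<phi> (restrict (\<lambda>i. \<xi> i \<omega>) {1..<n})"
      by blast
    have [measurable]: "(\<lambda>v. restrict v {1..<n}) \<in>
        measurable (PiM {1..<Suc n} (\<lambda>_. T)) (PiM {1..<n} (\<lambda>_. T))"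
      by (rule measurable_restrict_subset) auto
    have [measurable]: "(\<lambda>v. v n) \<in> measurable (PiM {1..<Suc n} (\<lambda>_. T)) T"
      using Suc.hyps by (intro measurable_component_singleton) auto
    note [measurable] = meas[OF Suc.hyps]
    have "(\<lambda>v. \<Psi> n (\<phi> (restrict v {1..<n}), v n)) \<in> measurable (PiM {1..<Suc n} (\<lambda>_. T)) S"
      by measurable
    moreover have "X (Suc n) \<omega> = \<Psi> n (\<phi> (restrict (restrict (\<lambda>i. \<xi> i \<omega>) {1..<Suc n}) {1..<n}),
        restrict (\<lambda>i. \<xi> i \<omega>) {1..<Suc n} n)" if "\<omega> \<in> space M" for \<omega>
    proof -
      have "restrict (restrict (\<lambda>i. \<xi> i \<omega>) {1..<Suc n}) {1..<n} = restrict (\<lambda>i. \<xi> i \<omega>) {1..<n}"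
        by auto
      then show ?thesis
        using eq[OF that] step[OF Suc.hyps that] Suc.hyps by simp
    qed
    ultimately show ?case
      by (intro bexI[of _ "\<lambda>v. \<Psi> n (\<phi> (restrict v {1..<n}), v n)"] ballI)
  qed
  then obtain \<phi> where \<phi>: "\<phi> \<in> measurable (PiM {1..<k} (\<lambda>_. T)) S"
    and eq: "\<And>\<omega>. \<omega> \<in> space M \<Longrightarrow> X k \<omega> = \<phi> (restrict (\<lambda>i. \<xi> i \<omega>) {1..<k})"
    by blast
  let ?A = "PiM {1..<k} (\<lambda>_. T)" and ?B = "PiM {k} (\<lambda>_. T)"
  let ?U = "\<lambda>\<omega>. restrict (\<lambda>i. \<xi> i \<omega>) {1..<k}" and ?W = "\<lambda>\<omega>. restrict (\<lambda>i. \<xi> i \<omega>) {k}"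
  \<comment> \<open>Disjoint blocks of draws are independent; pushing their joint law forward by
    \<open>\<phi>\<close> and by evaluation at \<open>k\<close> yields the claim.\<close>
  have "indep_var ?A ?U ?B ?W"
    using k by (intro indep_var_restrict[OF ind]) auto
  then have UW [measurable]: "random_variable ?A ?U" "random_variable ?B ?W"
    and joint: "distr M (?A \<Otimes>\<^sub>M ?B) (\<lambda>\<omega>. (?U \<omega>, ?W \<omega>)) = distr M ?A ?U \<Otimes>\<^sub>M distr M ?B ?W"
    unfolding indep_var_distribution_eq by auto
  note \<phi> [measurable]
  have ev [measurable]: "(\<lambda>v. v k) \<in> measurable ?B T"
    by (rule measurable_component_singleton) simp
  have "random_variable S (\<lambda>\<omega>. \<phi> (?U \<omega>))"
    by measurable
  then show "random_variable S (X k)"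
    by (simp add: eq cong: measurable_cong)
  have law_X: "distr M S (X k) = distr (distr M ?A ?U) S \<phi>"
    unfolding distr_distr[OF \<phi> UW(1)] by (rule distr_cong) (simp_all add: eq)
  have law_\<xi>: "distr M T (\<xi> k) = distr (distr M ?B ?W) T (\<lambda>v. v k)"
    unfolding distr_distr[OF ev UW(2)] by (rule distr_cong) simp_all
  have \<phi>': "\<phi> \<in> measurable (distr M ?A ?U) S" and ev': "(\<lambda>v. v k) \<in> measurable (distr M ?B ?W) T"
    using \<phi> ev by simp_all
  interpret W: prob_space "distr (distr M ?B ?W) T (\<lambda>v. v k)"
    by (intro prob_space.prob_space_distr prob_space_distr) measurable
  have "distr M S (X k) \<Otimes>\<^sub>M distr M T (\<xi> k)
      = distr (distr M ?A ?U \<Otimes>\<^sub>M distr M ?B ?W) (S \<Otimes>\<^sub>M T) (\<lambda>(u, v). (\<phi> u, v k))"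
    unfolding law_X law_\<xi>
    by (rule pair_measure_distr[OF \<phi>' ev' W.sigma_finite_measure_axioms])
  also have "\<dots> = distr M (S \<Otimes>\<^sub>M T) (\<lambda>\<omega>. (X k \<omega>, \<xi> k \<omega>))"
    unfolding joint[symmetric]
    by (subst distr_distr, measurable) (rule distr_cong, simp_all add: eq)
  finally show "distr M (S \<Otimes>\<^sub>M T) (\<lambda>\<omega>. (X k \<omega>, \<xi> k \<omega>)) = distr M S (X k) \<Otimes>\<^sub>M distr M T (\<xi> k)"
    by (rule sym)
qed

section \<open>Real sequences: telescoping and vanishing ratios\<close>

lemma telescope_sum_bound:
  fixes \<Phi> :: "nat \<Rightarrow> real"
  assumes "\<And>k. k \<ge> 1 \<Longrightarrow> \<Phi> k - \<Phi> (Suc k) \<le> w k"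
  shows "\<Phi> 1 - \<Phi> (Suc T) \<le> (\<Sum>k=1..T. w k)"
proof (induction T)
  case (Suc T)
  then show ?case
    using assms[of "Suc T"] by simp
qed simp

text \<open>\<open>K\<close> may depend on \<open>\<delta>\<close> because it is fixed while
  \<open>A\<close> tends to infinity; a small \<open>\<delta>\<close> lets the term in
  \<open>S T\<close> be absorbed on the left.\<close>

lemma ratio_tendsto_0:
  fixes A S :: "nat \<Rightarrow> real"
  assumes A: "filterlim A at_top sequentially" and S: "\<And>T. S T \<ge> 0"
    and bound: "\<And>\<delta>. \<delta> > 0 \<Longrightarrow> \<exists>K. \<forall>T. S T \<le> K + \<delta> * (A T + S T)"
  shows "(\<lambda>T. S T / A T) \<longlonglongrightarrow> 0"
proof (rule LIMSEQ_I)
  fix \<epsilon> :: real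
  assume \<epsilon>: "\<epsilon> > 0"
  \<comment> \<open>The \<open>1 / 2\<close> absorbs half of \<open>S T\<close>; what remains is at
    most \<open>2 * \<bar>K\<bar> + A T * \<epsilon> / 4\<close>, and eventually
    \<open>2 * \<bar>K\<bar>\<close> is at most \<open>A T * \<epsilon> / 2\<close>.\<close>
  define \<delta> where "\<delta> = min (1 / 2) (\<epsilon> / 8)"
  have \<delta>: "\<delta> > 0" "\<delta> \<le> 1 / 2" "\<delta> \<le> \<epsilon> / 8"
    using \<epsilon> by (auto simp: \<delta>_def)
  obtain K where K: "\<And>T. S T \<le> K + \<delta> * (A T + S T)"
    using bound[OF \<delta>(1)] by blast
  have "eventually (\<lambda>T. A T \<ge> max 1 (4 * \<bar>K\<bar> / \<epsilon>)) sequentially"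
    using A by (simp only: filterlim_at_top)
  then obtain T\<^sub>0 where T\<^sub>0: "\<And>T. T \<ge> T\<^sub>0 \<Longrightarrow> A T \<ge> max 1 (4 * \<bar>K\<bar> / \<epsilon>)"
    unfolding eventually_sequentially by blast
  have "norm (S T / A T - 0) < \<epsilon>" if "T \<ge> T\<^sub>0" for T
  proof -
    have A1: "A T \<ge> 1" and "4 * \<bar>K\<bar> / \<epsilon> \<le> A T"
      using T\<^sub>0[OF that] by auto
    then have KA: "4 * \<bar>K\<bar> \<le> A T * \<epsilon>"
      using \<epsilon> by (simp add: pos_divide_le_eq)
    have "S T \<le> K + \<delta> * A T + \<delta> * S T"
      using K[of T] by (simp add: distrib_left)
    also have "\<delta> * S T \<le> 1 / 2 * S T"
      using \<delta> S by (intro mult_right_mono) auto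
    also have "\<delta> * A T \<le> \<epsilon> / 8 * A T"
      using \<delta> A1 by (intro mult_right_mono) auto
    finally have "S T \<le> 2 * \<bar>K\<bar> + (A T * \<epsilon>) / 4"
      by (simp add: field_simps)
    moreover have "A T * \<epsilon> > 0"
      using A1 \<epsilon> by simp
    ultimately have "S T < A T * \<epsilon>"
      using KA by linarith
    then show ?thesis
      using S[of T] A1 by (simp add: pos_divide_less_eq mult.commute)
  qed
  then show "\<exists>T\<^sub>0. \<forall>T\<ge>T\<^sub>0. norm (S T / A T - 0) < \<epsilon>"
    by blast
qed

text \<open>Integrability is part of the conclusion because a non-integrable function has integral 0
  by convention. Finiteness of the first limit is expressed by \<open>convergent\<close> and
  asserted for \<open>f\<close> bounded below, where the descent estimate caps the sums; the limit
  of the average carries no such condition.\<close>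

theorem theorem3p2:
  fixes f :: "real^'n \<Rightarrow> real"
    and F :: "real^'n \<Rightarrow> real \<Rightarrow> real"
    and g :: "real^'n \<Rightarrow> real^'m \<Rightarrow> real \<Rightarrow> real^'n"
    and P :: "(real^'m) measure"
    and M :: "'s measure"
    and \<xi> :: "nat \<Rightarrow> 's \<Rightarrow> real^'m"
    and x :: "nat \<Rightarrow> 's \<Rightarrow> real^'n"
    and x\<^sub>1 :: "real^'n"
    and \<alpha> \<mu> :: "nat \<Rightarrow> real"
    and G C C\<^sub>0 C\<^sub>1 d :: real
  assumes f_lip: "locally_lipschitz f"
    and smoothing: "smoothing_function f F"
    and P_prob: "prob_space P"
    and P_sets: "sets P = sets borel"
    and g_meas: "\<And>s. s > 0 \<Longrightarrow> (\<lambda>(y, z). g y z s) \<in> borel_measurable (borel \<Otimes>\<^sub>M borel)"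
    and unbiased: "\<And>y s. s > 0 \<Longrightarrow>
      has_bochner_integral P (\<lambda>z. g y z s) (grad (\<lambda>v. F v s) y)"
    and "G > 0"
    and second_moment: "\<And>y s. s > 0 \<Longrightarrow>
      integrable P (\<lambda>z. (norm (g y z s))\<^sup>2) \<and> (LINT z|P. (norm (g y z s))\<^sup>2) \<le> G\<^sup>2 / s\<^sup>2"
    and "C > 0"
    and approx_error: "\<And>y s. s > 0 \<Longrightarrow> \<bar>f y - F y s\<bar> \<le> C * s"
    and "C\<^sub>0 > 0"
    and grad_lip: "\<And>s. s > 0 \<Longrightarrow> (C\<^sub>0 / s)-lipschitz_on UNIV (grad (\<lambda>v. F v s))"
    and "C\<^sub>1 > 0"
    and param_lip: "\<And>y s s'. s > 0 \<Longrightarrow> s' > 0 \<Longrightarrow> \<bar>F y s' - F y s\<bar> \<le> C\<^sub>1 * \<bar>s' - s\<bar>"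
    and "1 < d" and "d < 2"
    and ssg: "ssg_method M P g x\<^sub>1 \<alpha> \<mu> \<xi> x"
    and steps_diverge: "filterlim (\<lambda>T. \<Sum>k=1..T. \<alpha> k) at_top sequentially"
    and steps_powr_summable: "summable (\<lambda>k. \<alpha> (Suc k) powr d)"
    and mu_eq: "\<And>k. k \<ge> 1 \<Longrightarrow> \<mu> k = \<alpha> k powr (- d / 3 + 2 / 3)"
  shows "(\<forall>T. integrable M (\<lambda>\<omega>. \<Sum>k=1..T. \<alpha> k * (norm (grad (\<lambda>v. F v (\<mu> k)) (x k \<omega>)))\<^sup>2))
    \<and> (bdd_below (range f) \<longrightarrow>
        convergent (\<lambda>T. LINT \<omega>|M. (\<Sum>k=1..T. \<alpha> k * (norm (grad (\<lambda>v. F v (\<mu> k)) (x k \<omega>)))\<^sup>2)))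
    \<and> (\<lambda>T. LINT \<omega>|M. (1 / (\<Sum>k=1..T. \<alpha> k)) *
          (\<Sum>k=1..T. \<alpha> k * (norm (grad (\<lambda>v. F v (\<mu> k)) (x k \<omega>)))\<^sup>2)) \<longlonglongrightarrow> 0"
proof -

  \<comment> \<open>The data of the method and bounds on the smoothed gradient\<close>
  interpret M: prob_space M
    using ssg by (simp add: ssg_method_def)
  interpret P: prob_space P
    by (rule P_prob)
  have indep: "M.indep_vars (\<lambda>_. borel) \<xi> {1..}"
    and law: "\<And>k. k \<ge> 1 \<Longrightarrow> distr M borel (\<xi> k) = P"
    and pos: "\<And>k. k \<ge> 1 \<Longrightarrow> \<alpha> k > 0" "\<And>k. k \<ge> 1 \<Longrightarrow> \<mu> k > 0"
    and \<mu>_dec: "\<And>k. k \<ge> 1 \<Longrightarrow> \<mu> (Suc k) \<le> \<mu> k"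
    and init: "\<And>\<omega>. \<omega> \<in> space M \<Longrightarrow> x 1 \<omega> = x\<^sub>1"
    and iter: "\<And>k \<omega>. k \<ge> 1 \<Longrightarrow> \<omega> \<in> space M \<Longrightarrow>
      x (Suc k) \<omega> = x k \<omega> - \<alpha> k *\<^sub>R g (x k \<omega>) (\<xi> k \<omega>) (\<mu> k)"
    using ssg by (auto simp: ssg_method_def)
  have \<mu>_le: "\<mu> k \<le> \<mu> 1" if "k \<ge> 1" for k
    using that by (induction k rule: nat_induct_at_least) (auto intro: order_trans[OF \<mu>_dec])
  have \<xi>_rv: "M.random_variable borel (\<xi> k)" if "k \<ge> 1" for k
    using indep that by (auto simp: M.indep_vars_def)

  let ?D = "\<lambda>s. grad (\<lambda>v. F v s)"
  have gderiv: "GDERIV (\<lambda>v. F v s) y :> ?D s y" if "s > 0" for s y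
    using smoothing that
    by (intro GDERIV_grad) (auto simp: smoothing_function_def continuously_differentiable_def)
  \<comment> \<open>The gradient is the mean of its estimates, so Jensen's inequality transfers the
    second moment bound to it, at every \<open>s > 0\<close>.\<close>
  have D_sq: "(norm (?D s y))\<^sup>2 \<le> G\<^sup>2 / s\<^sup>2" if "s > 0" for s y
  proof -
    have "(norm (LINT z|P. g y z s))\<^sup>2 \<le> (LINT z|P. (norm (g y z s))\<^sup>2)"
      using unbiased[OF that, of y] second_moment[OF that, of y]
      by (intro P.norm_expectation_sq_le) (auto simp: has_bochner_integral_iff)
    also have "\<dots> \<le> G\<^sup>2 / s\<^sup>2"
      using second_moment[OF that] by blast
    finally show ?thesis
      using unbiased[OF that, of y] by (simp add: has_bochner_integral_iff)
  qed
  have D_bound: "norm (?D s y) \<le> G / s" if "s > 0" for s y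
    by (rule power2_le_imp_le) (use D_sq[OF that, of y] that \<open>G > 0\<close> in \<open>auto simp: power_divide\<close>)
  have D_meas [measurable]: "?D s \<in> borel_measurable borel" if "s > 0" for s
    by (intro borel_measurable_continuous_onI lipschitz_on_continuous_on[OF grad_lip[OF that]])

  \<comment> \<open>Laws of the iterates and one step of the method\<close>
  have step_meas: "(\<lambda>(y, z). y - \<alpha> k *\<^sub>R g y z (\<mu> k)) \<in> borel_measurable (borel \<Otimes>\<^sub>M borel)"
    if "k \<ge> 1" for k
  proof -
    note [measurable] = g_meas[OF pos(2)[OF that]]
    show ?thesis
      by measurable
  qed
  have x_rv: "M.random_variable borel (x k)"
    and joint: "distr M (borel \<Otimes>\<^sub>M borel) (\<lambda>\<omega>. (x k \<omega>, \<xi> k \<omega>)) = distr M borel (x k) \<Otimes>\<^sub>M P"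
    if "k \<ge> 1" for k
    using M.product_law_recursion[OF indep, of x x\<^sub>1 borel
        "\<lambda>k (y, z). y - \<alpha> k *\<^sub>R g y z (\<mu> k)" k] init iter step_meas that law
    by auto

  \<comment> \<open>The step is taken with the estimate at \<open>\<mu> k\<close>, while
    \<open>F\<close> is followed at an arbitrary \<open>s\<close>: later \<open>s\<close> is either
    \<open>\<mu> k\<close> or a fixed parameter.\<close>
  have one_step: "integrable M (\<lambda>\<omega>. F (x (Suc k) \<omega>) s)"
    "\<bar>M.expectation (\<lambda>\<omega>. F (x (Suc k) \<omega>) s) - M.expectation (\<lambda>\<omega>. F (x k \<omega>) s)
       + \<alpha> k * M.expectation (\<lambda>\<omega>. inner (?D (\<mu> k) (x k \<omega>)) (?D s (x k \<omega>)))\<bar>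
     \<le> C\<^sub>0 / s * ((\<alpha> k)\<^sup>2 * (G\<^sup>2 / (\<mu> k)\<^sup>2))"
    if k: "k \<ge> 1" and s: "s > 0" and int: "integrable M (\<lambda>\<omega>. F (x k \<omega>) s)" for k s
  proof -
    note step = M.stochastic_step[OF x_rv[OF k] \<xi>_rv[OF k] law[OF k] joint[OF k] g_meas[OF pos(2)[OF k]]
        unbiased[OF pos(2)[OF k]] _ _ gderiv[OF s] grad_lip[OF s] D_bound[OF s] int,
        of "G\<^sup>2 / (\<mu> k)\<^sup>2" "\<alpha> k"]
    have "integrable M (\<lambda>\<omega>. F (x k \<omega> - \<alpha> k *\<^sub>R g (x k \<omega>) (\<xi> k \<omega>) (\<mu> k)) s)"
      by (rule step(1)) (use second_moment[OF pos(2)[OF k]] in auto)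
    then show "integrable M (\<lambda>\<omega>. F (x (Suc k) \<omega>) s)"
      by (simp add: iter[OF k] cong: Bochner_Integration.integrable_cong)
    have "M.expectation (\<lambda>\<omega>. F (x (Suc k) \<omega>) s)
        = M.expectation (\<lambda>\<omega>. F (x k \<omega> - \<alpha> k *\<^sub>R g (x k \<omega>) (\<xi> k \<omega>) (\<mu> k)) s)"
      by (intro Bochner_Integration.integral_cong) (auto simp: iter[OF k])
    then show "\<bar>M.expectation (\<lambda>\<omega>. F (x (Suc k) \<omega>) s) - M.expectation (\<lambda>\<omega>. F (x k \<omega>) s)
       + \<alpha> k * M.expectation (\<lambda>\<omega>. inner (?D (\<mu> k) (x k \<omega>)) (?D s (x k \<omega>)))\<bar>
     \<le> C\<^sub>0 / s * ((\<alpha> k)\<^sup>2 * (G\<^sup>2 / (\<mu> k)\<^sup>2))"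
      using step(2) second_moment[OF pos(2)[OF k]] by auto
  qed
  \<comment> \<open>The start is deterministic, so integrability holds at index 1 and each step
    preserves it.\<close>
  have F_int: "integrable M (\<lambda>\<omega>. F (x k \<omega>) s)" if "k \<ge> 1" "s > 0" for k s
    using that
  proof (induction k rule: nat_induct_at_least)
    case base
    have "integrable M (\<lambda>\<omega>. F x\<^sub>1 s)"
      by simp
    then show ?case
      using init by (simp cong: Bochner_Integration.integrable_cong)
  next
    case (Suc k)
    then show ?case
      using one_step(1) by blast
  qed

  \<comment> \<open>Expected values and weighted sums along the iterates\<close>
  have sq_int: "integrable M (\<lambda>\<omega>. (norm (?D s (x k \<omega>)))\<^sup>2)" if "k \<ge> 1" "s > 0" for k s
  proof -
    note [measurable] = x_rv[OF that(1)] D_meas[OF that(2)]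
    show ?thesis
      by (rule M.integrable_const_bound[where B = "G\<^sup>2 / s\<^sup>2"]) (auto intro!: AE_I2 D_sq that)
  qed
  define \<Psi> where "\<Psi> s k = M.expectation (\<lambda>\<omega>. F (x k \<omega>) s)" for s k
  define e where "e k = M.expectation (\<lambda>\<omega>. (norm (?D (\<mu> k) (x k \<omega>)))\<^sup>2)" for k
  define S where "S T = (\<Sum>k=1..T. \<alpha> k * e k)" for T
  define A where "A T = (\<Sum>k=1..T. \<alpha> k)" for T
  define Q where "Q = (\<Sum>k. \<alpha> (Suc k) powr d)"
  have e_nonneg: "e k \<ge> 0" for k
    by (auto simp: e_def)
  have int_S: "integrable M (\<lambda>\<omega>. \<Sum>k=1..T. \<alpha> k * (norm (?D (\<mu> k) (x k \<omega>)))\<^sup>2)" for T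
    by (intro Bochner_Integration.integrable_sum integrable_mult_right sq_int)
      (auto intro: pos)
  have S_eq: "M.expectation (\<lambda>\<omega>. \<Sum>k=1..T. \<alpha> k * (norm (?D (\<mu> k) (x k \<omega>)))\<^sup>2) = S T" for T
    unfolding S_def e_def
    by (subst Bochner_Integration.integral_sum) (auto intro!: integrable_mult_right sq_int pos)

  have \<Psi>_param: "\<Psi> s k \<le> \<Psi> s' k + C\<^sub>1 * \<bar>s - s'\<bar>" if "k \<ge> 1" "s > 0" "s' > 0" for k s s'
  proof -
    have "\<Psi> s k \<le> M.expectation (\<lambda>\<omega>. F (x k \<omega>) s' + C\<^sub>1 * \<bar>s - s'\<bar>)"
      unfolding \<Psi>_def
    proof (rule integral_mono)
      show "F (x k \<omega>) s \<le> F (x k \<omega>) s' + C\<^sub>1 * \<bar>s - s'\<bar>" for \<omega>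
        using param_lip[OF that(3,2), of "x k \<omega>"] by linarith
    qed (use F_int that in auto)
    then show ?thesis
      using F_int[OF that(1,3)] by (simp add: \<Psi>_def M.prob_space)
  qed
  have powr_sum: "(\<Sum>k=1..T. \<alpha> k powr d) \<le> Q" for T
  proof -
    have "(\<Sum>k=1..T. \<alpha> k powr d) = (\<Sum>k<T. \<alpha> (Suc k) powr d)"
      by (simp add: sum.atLeast1_atMost_eq)
    then show ?thesis
      using sum_le_suminf[OF steps_powr_summable, of "{..<T}"] by (simp add: Q_def)
  qed
  \<comment> \<open>The smoothing parameters are chosen so that the second-order error is exactly of order
    \<open>\<alpha>\<^sub>k powr d\<close>.\<close>
  have \<alpha>_\<mu>: "(\<alpha> k)\<^sup>2 / (\<mu> k)^3 = \<alpha> k powr d" if "k \<ge> 1" for k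
  proof -
    have "(\<mu> k)^3 = \<alpha> k powr (2 - d)"
      using pos(1)[OF that] by (simp add: mu_eq[OF that] powr_power algebra_simps)
    moreover have "(\<alpha> k)\<^sup>2 = \<alpha> k powr 2"
      using pos(1)[OF that] by simp
    ultimately have "(\<alpha> k)\<^sup>2 / (\<mu> k)^3 = \<alpha> k powr (2 - (2 - d))"
      by (simp only: powr_diff)
    then show ?thesis
      by simp
  qed

  \<comment> \<open>Descent estimate\<close>
  have descent: "S T \<le> \<Psi> (\<mu> 1) 1 + C\<^sub>1 * \<mu> 1 - \<Psi> (\<mu> (Suc T)) (Suc T) + C\<^sub>0 * G\<^sup>2 * Q" for T
  proof -
    \<comment> \<open>Adding \<open>C\<^sub>1 * \<mu> k\<close> pays for the change of smoothing
      parameter, since \<open>\<mu>\<close> is nonincreasing; the minus sign fits the orientation of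
      the telescoping lemma.\<close>
    let ?\<Phi> = "\<lambda>k. - (\<Psi> (\<mu> k) k + C\<^sub>1 * \<mu> k)"
    have "?\<Phi> k - ?\<Phi> (Suc k) \<le> C\<^sub>0 * G\<^sup>2 * \<alpha> k powr d - \<alpha> k * e k" if k: "k \<ge> 1" for k
    proof -
      \<comment> \<open>For \<open>s = \<mu> k\<close> the cross term is the squared gradient norm,
        and the factors \<open>1 / \<mu> k\<close> from the Lipschitz constant and
        \<open>1 / (\<mu> k)\<^sup>2\<close> from the second moment combine to the cube.\<close>
      have "\<bar>\<Psi> (\<mu> k) (Suc k) - \<Psi> (\<mu> k) k + \<alpha> k * e k\<bar>
          \<le> C\<^sub>0 / \<mu> k * ((\<alpha> k)\<^sup>2 * (G\<^sup>2 / (\<mu> k)\<^sup>2))"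
        using one_step(2)[OF k pos(2)[OF k] F_int[OF k pos(2)[OF k]]]
        by (simp add: \<Psi>_def e_def power2_norm_eq_inner)
      also have "\<dots> = C\<^sub>0 * G\<^sup>2 * ((\<alpha> k)\<^sup>2 / (\<mu> k)^3)"
        by (simp add: power2_eq_square power3_eq_cube mult_ac)
      finally have "\<Psi> (\<mu> k) (Suc k) - \<Psi> (\<mu> k) k + \<alpha> k * e k \<le> C\<^sub>0 * G\<^sup>2 * \<alpha> k powr d"
        by (simp add: \<alpha>_\<mu>[OF k])
      moreover have "\<Psi> (\<mu> (Suc k)) (Suc k) \<le> \<Psi> (\<mu> k) (Suc k) + C\<^sub>1 * (\<mu> k - \<mu> (Suc k))"
        using \<Psi>_param[of "Suc k" "\<mu> (Suc k)" "\<mu> k"] pos k \<mu>_dec[OF k] by simp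
      ultimately show ?thesis
        by (simp add: right_diff_distrib)
    qed
    then have "?\<Phi> 1 - ?\<Phi> (Suc T) \<le> (\<Sum>k=1..T. C\<^sub>0 * G\<^sup>2 * \<alpha> k powr d - \<alpha> k * e k)"
      by (rule telescope_sum_bound)
    also have "\<dots> = C\<^sub>0 * G\<^sup>2 * (\<Sum>k=1..T. \<alpha> k powr d) - S T"
      by (simp add: sum_subtractf sum_distrib_left S_def)
    also have "C\<^sub>0 * G\<^sup>2 * (\<Sum>k=1..T. \<alpha> k powr d) \<le> C\<^sub>0 * G\<^sup>2 * Q"
      using powr_sum \<open>C\<^sub>0 > 0\<close> by (intro mult_left_mono) auto
    finally have "S T \<le> \<Psi> (\<mu> 1) 1 + C\<^sub>1 * \<mu> 1 - \<Psi> (\<mu> (Suc T)) (Suc T) - C\<^sub>1 * \<mu> (Suc T) + C\<^sub>0 * G\<^sup>2 * Q"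
      by simp
    moreover have "C\<^sub>1 * \<mu> (Suc T) \<ge> 0"
      using \<open>C\<^sub>1 > 0\<close> pos(2)[of "Suc T"] by simp
    ultimately show ?thesis
      by linarith
  qed

  \<comment> \<open>Convergence of the weighted sums for \<open>f\<close> bounded below\<close>
  have "convergent S" if bdd: "bdd_below (range f)"
  proof -
    obtain b where b: "\<And>y. b \<le> f y"
      using bdd unfolding bdd_below_def by auto
    \<comment> \<open>\<open>F\<close> at \<open>\<mu> k\<close> lies at most
      \<open>C * \<mu> k\<close> below \<open>f\<close>, hence at most \<open>C * \<mu> 1\<close>.
      The monotone sums \<open>S\<close> are therefore bounded.\<close>
    have "b - C * \<mu> 1 \<le> \<Psi> (\<mu> k) k" if "k \<ge> 1" for k
    proof -
      have "b - C * \<mu> 1 \<le> F (x k \<omega>) (\<mu> k)" for \<omega>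
        using approx_error[OF pos(2)[OF that], of "x k \<omega>"] b[of "x k \<omega>"]
          mult_left_mono[OF \<mu>_le[OF that], of C] \<open>C > 0\<close> by linarith
      then show ?thesis
        unfolding \<Psi>_def using F_int that pos by (intro M.integral_ge_const) auto
    qed
    then have "S T \<le> \<Psi> (\<mu> 1) 1 + C\<^sub>1 * \<mu> 1 - (b - C * \<mu> 1) + C\<^sub>0 * G\<^sup>2 * Q" for T
      using descent[of T] by (smt (verit) le_add1 plus_1_eq_Suc)
    moreover have "incseq S"
      unfolding S_def by (intro incseq_SucI) (simp add: e_nonneg pos less_imp_le)
    ultimately show ?thesis
      by (metis incseq_convergent convergentI)
  qed

  \<comment> \<open>Vanishing of the weighted average\<close>
  moreover
  \<comment> \<open>Without a lower bound on \<open>f\<close>, the value \<open>\<Psi> (\<mu> (Suc T)) (Suc T)\<close> is controlled by comparing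
    with a fixed large smoothing parameter \<open>s\<close>, for which the gradient is at most \<open>G / s\<close>.\<close>
  have "(\<lambda>T. S T / A T) \<longlonglongrightarrow> 0"
  proof (rule ratio_tendsto_0)
    show "filterlim A at_top sequentially"
      using steps_diverge by (simp add: A_def[abs_def])
    show "S T \<ge> 0" for T
      unfolding S_def by (intro sum_nonneg) (simp add: e_nonneg pos less_imp_le)
    fix \<delta> :: real
    assume \<delta>: "\<delta> > 0"
    \<comment> \<open>Chosen so that the gradient bound \<open>G / s\<close> equals
      \<open>2 * \<delta>\<close>.\<close>
    define s where "s = G / (2 * \<delta>)"
    have s: "s > 0" and \<delta>_eq: "\<delta> = G / s / 2"
      using \<delta> \<open>G > 0\<close> by (auto simp: s_def)
    \<comment> \<open>Here the error has only \<open>(\<mu> k)\<^sup>2\<close> in the denominator,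
      so it is \<open>\<alpha> k powr d\<close> times a spare factor \<open>\<mu> k\<close>, bounded
      by \<open>\<mu> 1\<close>.\<close>
    let ?K = "C\<^sub>0 * G\<^sup>2 * \<mu> 1 / s"
    have s_step: "\<Psi> s k - \<Psi> s (Suc k) \<le> \<delta> * (\<alpha> k + \<alpha> k * e k) + ?K * \<alpha> k powr d" if k: "k \<ge> 1" for k
    proof -
      let ?I = "M.expectation (\<lambda>\<omega>. inner (?D (\<mu> k) (x k \<omega>)) (?D s (x k \<omega>)))"
      note [measurable] = x_rv[OF k] D_meas[OF s] D_meas[OF pos(2)[OF k]]
      \<comment> \<open>Cauchy-Schwarz and \<open>2 * t \<le> 1 + t\<^sup>2\<close>: the two
        summands produce \<open>A T\<close> and \<open>S T\<close> after weighting and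
        summation.\<close>
      have pw: "norm (inner (?D (\<mu> k) y) (?D s y)) \<le> \<delta> * (1 + (norm (?D (\<mu> k) y))\<^sup>2)" for y
      proof -
        have "norm (inner (?D (\<mu> k) y) (?D s y)) \<le> norm (?D (\<mu> k) y) * (G / s)"
          using Cauchy_Schwarz_ineq2[of "?D (\<mu> k) y" "?D s y"]
            mult_left_mono[OF D_bound[OF s, of y], of "norm (?D (\<mu> k) y)"] by simp
        also have "\<dots> = \<delta> * (2 * norm (?D (\<mu> k) y))"
          by (simp add: \<delta>_eq)
        also have "\<dots> \<le> \<delta> * (1 + (norm (?D (\<mu> k) y))\<^sup>2)"
          using \<delta> sum_squares_bound[of 1 "norm (?D (\<mu> k) y)"] by (intro mult_left_mono) auto
        finally show ?thesis .
      qed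
      have dom: "integrable M (\<lambda>\<omega>. \<delta> * (1 + (norm (?D (\<mu> k) (x k \<omega>)))\<^sup>2))"
        using sq_int k pos by auto
      have "?I \<le> M.expectation (\<lambda>\<omega>. \<delta> * (1 + (norm (?D (\<mu> k) (x k \<omega>)))\<^sup>2))"
      proof (rule integral_mono)
        show "integrable M (\<lambda>\<omega>. inner (?D (\<mu> k) (x k \<omega>)) (?D s (x k \<omega>)))"
          by (rule Bochner_Integration.integrable_bound[OF dom])
            (auto intro!: AE_I2 order_trans[OF pw[unfolded real_norm_def]])
        show "inner (?D (\<mu> k) (x k \<omega>)) (?D s (x k \<omega>)) \<le> \<delta> * (1 + (norm (?D (\<mu> k) (x k \<omega>)))\<^sup>2)" for \<omega>
          using pw[of "x k \<omega>"] by simp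
      qed (rule dom)
      also have "\<dots> = \<delta> * (1 + e k)"
        using sq_int[OF k pos(2)[OF k]] by (simp add: e_def M.prob_space)
      finally have "\<alpha> k * ?I \<le> \<alpha> k * (\<delta> * (1 + e k))"
        using pos(1)[OF k] by (intro mult_left_mono) auto
      moreover have "\<bar>\<Psi> s (Suc k) - \<Psi> s k + \<alpha> k * ?I\<bar> \<le> C\<^sub>0 / s * ((\<alpha> k)\<^sup>2 * (G\<^sup>2 / (\<mu> k)\<^sup>2))"
        using one_step(2)[OF k s F_int[OF k s]] by (simp add: \<Psi>_def)
      moreover have "C\<^sub>0 / s * ((\<alpha> k)\<^sup>2 * (G\<^sup>2 / (\<mu> k)\<^sup>2)) \<le> ?K * \<alpha> k powr d"
      proof -
        have "C\<^sub>0 / s * ((\<alpha> k)\<^sup>2 * (G\<^sup>2 / (\<mu> k)\<^sup>2)) = (C\<^sub>0 * G\<^sup>2 / s * \<alpha> k powr d) * \<mu> k"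
          using pos(2)[OF k] by (simp add: \<alpha>_\<mu>[OF k, symmetric] power2_eq_square power3_eq_cube mult_ac)
        also have "\<dots> \<le> (C\<^sub>0 * G\<^sup>2 / s * \<alpha> k powr d) * \<mu> 1"
          using \<mu>_le[OF k] \<open>C\<^sub>0 > 0\<close> s by (intro mult_left_mono) auto
        finally show ?thesis
          by (simp add: mult_ac)
      qed
      ultimately show ?thesis
        by (simp add: algebra_simps)
    qed
    have drift: "\<Psi> s 1 - \<Psi> s (Suc T) \<le> \<delta> * (A T + S T) + ?K * Q" for T
    proof -
      have "\<Psi> s 1 - \<Psi> s (Suc T) \<le> (\<Sum>k=1..T. \<delta> * (\<alpha> k + \<alpha> k * e k) + ?K * \<alpha> k powr d)"
        by (rule telescope_sum_bound) (rule s_step)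
      also have "(\<Sum>k=1..T. \<delta> * (\<alpha> k + \<alpha> k * e k) + ?K * \<alpha> k powr d)
          = \<delta> * (A T + S T) + ?K * (\<Sum>k=1..T. \<alpha> k powr d)"
        by (simp only: sum.distrib sum_distrib_left[symmetric] A_def S_def)
      also have "?K * (\<Sum>k=1..T. \<alpha> k powr d) \<le> ?K * Q"
        using powr_sum \<open>C\<^sub>0 > 0\<close> s pos(2)[of 1] by (intro mult_left_mono) auto
      finally show ?thesis
        by simp
    qed
    \<comment> \<open>The distance from \<open>s\<close> to all the smoothing parameters is bounded,
      so switching parameters costs a constant independent of \<open>T\<close>.\<close>
    have "\<Psi> s (Suc T) \<le> \<Psi> (\<mu> (Suc T)) (Suc T) + C\<^sub>1 * (s + \<mu> 1)" for T
    proof -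
      have "\<bar>s - \<mu> (Suc T)\<bar> \<le> s + \<mu> 1"
        using s pos(2)[of "Suc T"] \<mu>_le[of "Suc T"] by simp
      then have "C\<^sub>1 * \<bar>s - \<mu> (Suc T)\<bar> \<le> C\<^sub>1 * (s + \<mu> 1)"
        using \<open>C\<^sub>1 > 0\<close> by (intro mult_left_mono) auto
      then show ?thesis
        using \<Psi>_param[of "Suc T" s "\<mu> (Suc T)"] s pos(2)[of "Suc T"] by simp
    qed
    \<comment> \<open>\<open>descent\<close> bounds \<open>S T\<close> through the final value at
      \<open>\<mu> (Suc T)\<close>; this is compared with the value at \<open>s\<close>, which
      \<open>drift\<close> relates to the initial one.\<close>
    then have "S T \<le> (\<Psi> (\<mu> 1) 1 + C\<^sub>1 * \<mu> 1 + C\<^sub>0 * G\<^sup>2 * Q + C\<^sub>1 * (s + \<mu> 1) + ?K * Q - \<Psi> s 1)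
        + \<delta> * (A T + S T)" for T
      using descent[of T] drift[of T] by (smt (verit))
    then show "\<exists>K. \<forall>T. S T \<le> K + \<delta> * (A T + S T)"
      by blast
  qed
  ultimately show ?thesis
    using int_S by (simp add: S_eq A_def del: One_nat_def)
qed

end
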